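(* Let $n\geq3$ be odd, and let $\widehat Z_n=Z_{n,n}\sqcup X_n\sqcup X'_n$ be the canonical collinear completion of $Z_{n,n}=Z_{n,n}(a,b)$, where $\alpha=2\pi a/n$, $\beta=2\pi b/n$, $a,b\in\mathbb Z_n^\times$. For every $(r,s)\in\mathbb Z_n^2$ there is a unique $(i,j)\in\mathbb Z_n^2$ such that $$D_{r,s}=\{P_r,\,P'_s,\,A_{ij},\,B_{ij}\}$$ is an orthogonal context. Explicitly, $$i=(2a)^{-1}(r+s),\qquad j=(2b)^{-1}(s-r)\qquad\text{in }\mathbb Z_n.$$ Consequently, the completion determines a canonical family of $n^2$ additional orthogonal contexts. Each grid ray $A_{ij}$ and $B_{ij}$ occurs in exactly one of them, while each completion ray $P_r$ and $P'_s$ occurs in exactly $n$ of them.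
   Context: Work in $\mathbb P^3(\mathbb R)=\mathbb P(V)$, $V=\mathbb R^2\oplus\mathbb R^2$ with the standard Euclidean inner product; rays are points of $\mathbb P(V)$, and an orthogonal context is a set of four pairwise orthogonal rays. Let $\mathbb Z_n=\mathbb Z/n\mathbb Z$, $a,b\in\mathbb Z_n^\times$, $\alpha=2\pi a/n$, $\beta=2\pi b/n$, $u(\theta)=(\cos\theta,\sin\theta)$. The pair $(a,b)$ is assumed admissible: $-\cos(\alpha-\beta)/\cos(\alpha+\beta)$ is positive, finite and different from $1$; $c>0$ is defined by $c^2=-\cos(\alpha-\beta)/\cos(\alpha+\beta)$. For $(i,j)\in\mathbb Z_n^2$ put $A_{ij}=[u(i\alpha-j\beta):-c\,u(i\alpha+j\beta)]$, $B_{ij}=[c\,u(i\alpha-j\beta):u(i\alpha+j\beta)]$, $A=\{A_{ij}\}$, $B=\{B_{ij}\}$, $Z_{n,n}(a,b)=A\sqcup B$. The completion orbits are $X_n=\{P_r\}_{r\in\mathbb Z_n}$, $P_r=[u(\tfrac{\pi}{2}+\tfrac{2\pi r}{n}):0]$, and $X'_n=\{P'_s\}_{s\in\mathbb Z_n}$, $P'_s=[0:u(\tfrac{\pi}{2}+\tfrac{2\pi s}{n})]$, and $\widehat Z_n=Z_{n,n}\sqcup X_n\sqcup X'_n$. *)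

theory Defs
  imports "HOL-Analysis.Analysis" "HOL-Number_Theory.Residues"
begin

section \<open>Rays and orthogonal contexts\<close>

text \<open>The Euclidean space \<open>V = R^2 + R^2\<close>; the inner product of the product type is the sum
  of the inner products of the two components.\<close>

type_synonym V = "(real^2) \<times> (real^2)"

text \<open>Points of the projective space of \<open>V\<close> are its one-dimensional subspaces.\<close>

definition rays :: "V set set" where
  "rays = {L. subspace L \<and> dim L = 1}"

definition ray :: "real^2 \<Rightarrow> real^2 \<Rightarrow> V set" where
  "ray x y = span {(x, y)}"

definition orthogonal_rays :: "V set \<Rightarrow> V set \<Rightarrow> bool" where
  "orthogonal_rays L M \<longleftrightarrow> (\<forall>x\<in>L. \<forall>y\<in>M. orthogonal x y)"

definition orthogonal_context :: "V set set \<Rightarrow> bool" where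
  "orthogonal_context C \<longleftrightarrow> C \<subseteq> rays \<and> card C = 4 \<and> pairwise orthogonal_rays C"


section \<open>The grid and its completion\<close>

text \<open>\<open>Z/nZ\<close> is the ring \<open>residue_ring (int n)\<close>, whose elements are the integers
  \<open>0, \<dots>, n - 1\<close>. The objects below are defined for arbitrary integers; the
  \<open>_cong\<close> lemmas show that they depend only on residue classes modulo \<open>n\<close>.\<close>

abbreviation Zmod :: "nat \<Rightarrow> int ring" where
  "Zmod n \<equiv> residue_ring (int n)"

definition angle :: "nat \<Rightarrow> int \<Rightarrow> real" where
  "angle n a = 2 * pi * of_int a / of_nat n"

definition u :: "real \<Rightarrow> real^2" where
  "u \<theta> = vector [cos \<theta>, sin \<theta>]"

definition ratio :: "nat \<Rightarrow> int \<Rightarrow> int \<Rightarrow> real" where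
  "ratio n a b = - cos (angle n a - angle n b) / cos (angle n a + angle n b)"

text \<open>Division by zero yields zero in HOL, so finiteness of the ratio is a separate
  requirement on its denominator.\<close>

definition admissible :: "nat \<Rightarrow> int \<Rightarrow> int \<Rightarrow> bool" where
  "admissible n a b \<longleftrightarrow>
     cos (angle n a + angle n b) \<noteq> 0 \<and> ratio n a b > 0 \<and> ratio n a b \<noteq> 1"

definition A_ray :: "nat \<Rightarrow> int \<Rightarrow> int \<Rightarrow> real \<Rightarrow> int \<Rightarrow> int \<Rightarrow> V set" where
  "A_ray n a b c i j =
     ray (u (of_int i * angle n a - of_int j * angle n b))
         (- c *\<^sub>R u (of_int i * angle n a + of_int j * angle n b))"

definition B_ray :: "nat \<Rightarrow> int \<Rightarrow> int \<Rightarrow> real \<Rightarrow> int \<Rightarrow> int \<Rightarrow> V set" where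
  "B_ray n a b c i j =
     ray (c *\<^sub>R u (of_int i * angle n a - of_int j * angle n b))
         (u (of_int i * angle n a + of_int j * angle n b))"

definition P_ray :: "nat \<Rightarrow> int \<Rightarrow> V set" where
  "P_ray n r = ray (u (pi / 2 + 2 * pi * of_int r / of_nat n)) 0"

definition P'_ray :: "nat \<Rightarrow> int \<Rightarrow> V set" where
  "P'_ray n s = ray 0 (u (pi / 2 + 2 * pi * of_int s / of_nat n))"

definition A_orbit :: "nat \<Rightarrow> int \<Rightarrow> int \<Rightarrow> real \<Rightarrow> V set set" where
  "A_orbit n a b c = {A_ray n a b c i j | i j. i \<in> carrier (Zmod n) \<and> j \<in> carrier (Zmod n)}"

definition B_orbit :: "nat \<Rightarrow> int \<Rightarrow> int \<Rightarrow> real \<Rightarrow> V set set" where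
  "B_orbit n a b c = {B_ray n a b c i j | i j. i \<in> carrier (Zmod n) \<and> j \<in> carrier (Zmod n)}"

definition X_orbit :: "nat \<Rightarrow> V set set" where
  "X_orbit n = P_ray n ` carrier (Zmod n)"

definition X'_orbit :: "nat \<Rightarrow> V set set" where
  "X'_orbit n = P'_ray n ` carrier (Zmod n)"

text \<open>The unions below are disjoint, see \<open>orbits_disjoint\<close>.\<close>

definition Z_config :: "nat \<Rightarrow> int \<Rightarrow> int \<Rightarrow> real \<Rightarrow> V set set" where
  "Z_config n a b c = A_orbit n a b c \<union> B_orbit n a b c"

definition Z_completion :: "nat \<Rightarrow> int \<Rightarrow> int \<Rightarrow> real \<Rightarrow> V set set" where
  "Z_completion n a b c = Z_config n a b c \<union> X_orbit n \<union> X'_orbit n"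


section \<open>The additional contexts\<close>

definition D_set :: "nat \<Rightarrow> int \<Rightarrow> int \<Rightarrow> real \<Rightarrow> int \<Rightarrow> int \<Rightarrow> int \<Rightarrow> int \<Rightarrow> V set set" where
  "D_set n a b c r s i j = {P_ray n r, P'_ray n s, A_ray n a b c i j, B_ray n a b c i j}"

definition i_index :: "nat \<Rightarrow> int \<Rightarrow> int \<Rightarrow> int \<Rightarrow> int" where
  "i_index n a r s =
     inv\<^bsub>Zmod n\<^esub> (2 \<otimes>\<^bsub>Zmod n\<^esub> a) \<otimes>\<^bsub>Zmod n\<^esub> (r \<oplus>\<^bsub>Zmod n\<^esub> s)"

definition j_index :: "nat \<Rightarrow> int \<Rightarrow> int \<Rightarrow> int \<Rightarrow> int" where
  "j_index n b r s =
     inv\<^bsub>Zmod n\<^esub> (2 \<otimes>\<^bsub>Zmod n\<^esub> b) \<otimes>\<^bsub>Zmod n\<^esub> (s \<ominus>\<^bsub>Zmod n\<^esub> r)"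

definition D_family :: "nat \<Rightarrow> int \<Rightarrow> int \<Rightarrow> real \<Rightarrow> V set set set" where
  "D_family n a b c =
     {D_set n a b c r s (i_index n a r s) (j_index n b r s) | r s.
        r \<in> carrier (Zmod n) \<and> s \<in> carrier (Zmod n)}"


section \<open>Well-definedness\<close>

lemma u_periodic: "u (x + 2 * pi * of_int k) = u x"
proof -
  have "cos (x + 2 * pi * of_int k) = cos x" "sin (x + 2 * pi * of_int k) = sin x"
    by (simp_all add: cos_add sin_add)
  then show ?thesis by (simp add: u_def)
qed

lemma u_eqI:
  assumes "n > 0" and "[k = l] (mod int n)"
  shows "u (x + 2 * pi * of_int k / of_nat n) = u (x + 2 * pi * of_int l / of_nat n)"
proof -
  obtain m where "k = l + int n * m"
    using assms(2) by (metis cong_iff_lin cong_sym)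
  then have "x + 2 * pi * of_int k / of_nat n = x + 2 * pi * of_int l / of_nat n + 2 * pi * of_int m"
    using assms(1) by (simp add: field_simps)
  then show ?thesis by (simp only: u_periodic)
qed

lemma P_ray_cong:
  "n > 0 \<Longrightarrow> [r = r'] (mod int n) \<Longrightarrow> P_ray n r = P_ray n r'"
  "n > 0 \<Longrightarrow> [r = r'] (mod int n) \<Longrightarrow> P'_ray n r = P'_ray n r'"
  by (simp_all add: P_ray_def P'_ray_def u_eqI)

lemma u_grid:
  "u (of_int i * angle n a - of_int j * angle n b) = u (0 + 2 * pi * of_int (i * a - j * b) / of_nat n)"
  "u (of_int i * angle n a + of_int j * angle n b) = u (0 + 2 * pi * of_int (i * a + j * b) / of_nat n)"
  by (simp_all add: angle_def diff_divide_distrib add_divide_distrib algebra_simps)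

lemma grid_ray_cong:
  assumes "n > 0" "[a = a'] (mod int n)" "[b = b'] (mod int n)"
    "[i = i'] (mod int n)" "[j = j'] (mod int n)"
  shows "A_ray n a b c i j = A_ray n a' b' c i' j'"
    and "B_ray n a b c i j = B_ray n a' b' c i' j'"
proof -
  have "[i * a - j * b = i' * a' - j' * b'] (mod int n)"
       "[i * a + j * b = i' * a' + j' * b'] (mod int n)"
    using assms by (auto intro!: cong_diff cong_add cong_mult)
  from this[THEN u_eqI[OF assms(1), of _ _ 0]]
  show "A_ray n a b c i j = A_ray n a' b' c i' j'"
    and "B_ray n a b c i j = B_ray n a' b' c i' j'"
    unfolding A_ray_def B_ray_def u_grid by simp_all
qed

lemma ratio_cong:
  assumes "n > 0" "[a = a'] (mod int n)" "[b = b'] (mod int n)"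
  shows "ratio n a b = ratio n a' b'" and "admissible n a b \<longleftrightarrow> admissible n a' b'"
proof -
  have cos_u: "cos x = u x $ 1" for x by (simp add: u_def)
  have "[1 * a - 1 * b = 1 * a' - 1 * b'] (mod int n)"
       "[1 * a + 1 * b = 1 * a' + 1 * b'] (mod int n)"
    using assms by (auto intro!: cong_diff cong_add)
  from this[THEN u_eqI[OF assms(1), of _ _ 0]]
  have *: "cos (angle n a - angle n b) = cos (angle n a' - angle n b')"
          "cos (angle n a + angle n b) = cos (angle n a' + angle n b')"
    unfolding cos_u using u_grid[of 1 n _ 1] by simp_all
  show "ratio n a b = ratio n a' b'" using * by (simp add: ratio_def)
  then show "admissible n a b \<longleftrightarrow> admissible n a' b'" using * by (simp add: admissible_def)
qed

lemma norm_u [simp]: "norm (u x) = 1"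
  by (simp add: u_def norm_vec_def L2_set_def sum_2)

lemma u_nonzero [simp]: "u x \<noteq> 0"
  by (metis norm_u norm_zero zero_neq_one)

lemma ray_eqD:
  assumes "ray x y = ray x' y'"
  obtains k where "x = k *\<^sub>R x'" "y = k *\<^sub>R y'"
proof -
  have "(x, y) \<in> span {(x', y')}"
    using assms unfolding ray_def by (metis insertI1 span_base)
  then show ?thesis using that by (auto simp: span_singleton)
qed

lemma orbits_disjoint:
  assumes "admissible n a b" "c > 0" "c\<^sup>2 = ratio n a b"
  shows "disjnt (A_orbit n a b c) (B_orbit n a b c)"
    and "disjnt (Z_config n a b c) (X_orbit n)"
    and "disjnt (Z_config n a b c \<union> X_orbit n) (X'_orbit n)"
proof -
  have c: "c\<^sup>2 \<noteq> 1" using assms by (simp add: admissible_def)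
  have AB: "ray (u p) (- c *\<^sub>R u q) \<noteq> ray (c *\<^sub>R u p') (u q')" for p q p' q'
  proof
    assume "ray (u p) (- c *\<^sub>R u q) = ray (c *\<^sub>R u p') (u q')"
    then obtain k where "u p = k *\<^sub>R c *\<^sub>R u p'" "- c *\<^sub>R u q = k *\<^sub>R u q'"
      by (rule ray_eqD)
    then have "1 = \<bar>k\<bar> * c" "c = \<bar>k\<bar>"
      using assms(2) by (metis norm_u norm_scaleR mult.right_neutral abs_of_pos abs_minus_cancel)+
    then show False using c by (simp add: power2_eq_square)
  qed
  have P: "ray x y \<noteq> ray z 0" "ray x y \<noteq> ray 0 z" if "x \<noteq> 0" "y \<noteq> 0" for x y z
    using that by (auto elim!: ray_eqD)
  have PP: "ray x 0 \<noteq> ray 0 z" if "x \<noteq> 0" for x z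
    using that by (auto elim!: ray_eqD)
  show "disjnt (A_orbit n a b c) (B_orbit n a b c)"
    using AB AB[symmetric]
    by (auto simp: disjnt_iff A_orbit_def B_orbit_def A_ray_def B_ray_def)
  show "disjnt (Z_config n a b c) (X_orbit n)"
    using assms(2) by (auto simp: disjnt_iff Z_config_def A_orbit_def B_orbit_def X_orbit_def
        A_ray_def B_ray_def P_ray_def P P[symmetric])
  show "disjnt (Z_config n a b c \<union> X_orbit n) (X'_orbit n)"
    using assms(2) by (auto simp: disjnt_iff Z_config_def A_orbit_def B_orbit_def X_orbit_def
        X'_orbit_def A_ray_def B_ray_def P_ray_def P'_ray_def P P[symmetric] PP PP[symmetric])
qed

end

theory Submission imports Defs
begin

text \<open>
  Since \<open>n\<close> is odd, two vectors \<open>u\<close> at angles in \<open>(2\<pi>/n)\<int>\<close> are parallel only if the angles agree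
  modulo \<open>2\<pi>\<close>. Hence \<open>P\<^sub>r\<close>, which is a quarter turn away from direction \<open>r\<close>, is orthogonal
  to \<open>A\<^sub>i\<^sub>j\<close> (or \<open>B\<^sub>i\<^sub>j\<close>) iff \<open>ia - jb = r\<close> in \<open>\<int>\<^sub>n\<close>, and \<open>P'\<^sub>s\<close> is so iff \<open>ia + jb = s\<close>. As \<open>2a\<close> and
  \<open>2b\<close> are units, \<open>(i, j) \<mapsto> (ia - jb, ia + jb)\<close> is a bijection of \<open>\<int>\<^sub>n\<^sup>2\<close>, and indexing the new
  contexts by \<open>(r, s)\<close> makes all the counts immediate.
\<close>

section \<open>Plane directions at multiples of a full turn over \<open>n\<close>\<close>

lemma inner_u: "u x \<bullet> u y = cos (x - y)"
  by (simp add: u_def inner_vec_def sum_2 cos_diff)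

lemma u_parallel_imp_sin_diff_eq_0:
  assumes "u x = k *\<^sub>R u y"
  shows "sin (x - y) = 0"
proof -
  have "cos x = k * cos y" "sin x = k * sin y"
    using assms by (simp_all add: u_def vec_eq_iff forall_2)
  then show ?thesis by (simp add: sin_diff)
qed

text \<open>The zeros of sine are the integer multiples of \<pi>, so the condition reads
  \<open>2 * m = n * k\<close> for some integer \<open>k\<close>; the factor 2 cancels because
  \<open>n\<close> is odd.\<close>

lemma sin_angle_eq_0_iff:
  assumes "odd n"
  shows "sin (2 * pi * of_int m / of_nat n) = 0 \<longleftrightarrow> int n dvd m"
proof -
  have n: "real n \<noteq> 0" using assms by (auto intro: odd_pos)
  have "sin (2 * pi * of_int m / of_nat n) = 0 \<longleftrightarrow> (\<exists>k::int. 2 * pi * of_int m / of_nat n = of_int k * pi)"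
    by (rule sin_zero_iff_int2)
  also have "\<dots> \<longleftrightarrow> (\<exists>k::int. of_int (2 * m) = (of_int (int n * k) :: real))"
    using n by (simp add: field_simps)
  also have "\<dots> \<longleftrightarrow> int n dvd 2 * m"
    by (simp only: of_int_eq_iff dvd_def)
  also have "\<dots> \<longleftrightarrow> int n dvd m"
    using assms by (simp add: coprime_dvd_mult_right_iff)
  finally show ?thesis .
qed

text \<open>The offset \<open>x\<close> drops out of the difference of the angles; it is \<pi>/2 for
  completion rays and 0 for grid rays. A negative \<open>k\<close> is allowed, so opposite
  directions are covered too.\<close>

lemma u_parallel_imp_cong:
  assumes "odd n" "u (x + 2 * pi * of_int p / of_nat n) = k *\<^sub>R u (x + 2 * pi * of_int q / of_nat n)"
  shows "[p = q] (mod int n)"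
proof -
  have "sin (2 * pi * of_int (p - q) / of_nat n) = 0"
    using u_parallel_imp_sin_diff_eq_0[OF assms(2)] by (simp add: diff_divide_distrib algebra_simps)
  then show ?thesis unfolding sin_angle_eq_0_iff[OF assms(1)] by (simp add: cong_iff_dvd_diff)
qed

text \<open>The inner product is the cosine of the angle difference, and the quarter turn makes it a
  sine.\<close>

lemma inner_u_quarter_turn_eq_0_iff:
  assumes "odd n"
  shows "u (pi / 2 + 2 * pi * of_int r / of_nat n) \<bullet> u (2 * pi * of_int p / of_nat n) = 0
    \<longleftrightarrow> [p = r] (mod int n)"
proof -
  have "u (pi / 2 + 2 * pi * of_int r / of_nat n) \<bullet> u (2 * pi * of_int p / of_nat n)
      = cos (pi / 2 - 2 * pi * of_int (p - r) / of_nat n)"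
    unfolding inner_u by (simp add: diff_divide_distrib algebra_simps)
  also have "\<dots> = sin (2 * pi * of_int (p - r) / of_nat n)"
    by (simp add: cos_diff)
  finally show ?thesis
    by (simp only: sin_angle_eq_0_iff[OF assms] cong_iff_dvd_diff)
qed

section \<open>Equality and orthogonality of rays\<close>

lemma ray_in_rays:
  assumes "x \<noteq> 0 \<or> y \<noteq> 0"
  shows "ray x y \<in> rays"
  using assms by (auto simp: rays_def ray_def zero_prod_def)

text \<open>Each generator is a multiple of the other. This separates completion rays, which have a
  zero component, from grid rays, which have none.\<close>

lemma ray_eq_imp_zero_iff:
  assumes "ray x y = ray x' y'"
  shows "(x = 0 \<longleftrightarrow> x' = 0) \<and> (y = 0 \<longleftrightarrow> y' = 0)"
  using assms by (metis ray_eqD scaleR_zero_right)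

text \<open>By bilinearity it suffices to test the generators of the two lines.\<close>

lemma orthogonal_rays_ray_iff:
  "orthogonal_rays (ray x y) (ray x' y') \<longleftrightarrow> x \<bullet> x' + y \<bullet> y' = 0"
proof
  assume "orthogonal_rays (ray x y) (ray x' y')"
  then have "orthogonal (x, y) (x', y')"
    by (auto simp: orthogonal_rays_def ray_def span_base)
  then show "x \<bullet> x' + y \<bullet> y' = 0" by (simp add: orthogonal_def inner_Pair)
next
  assume "x \<bullet> x' + y \<bullet> y' = 0"
  then have "k * (l * (x \<bullet> x')) + k * (l * (y \<bullet> y')) = 0" for k l :: real
    by (metis distrib_left mult_zero_right)
  then show "orthogonal_rays (ray x y) (ray x' y')"
    by (auto simp: orthogonal_rays_def ray_def span_singleton orthogonal_def inner_Pair)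
qed

lemma orthogonal_rays_commute: "orthogonal_rays L M \<longleftrightarrow> orthogonal_rays M L"
  by (auto simp: orthogonal_rays_def orthogonal_commute)

lemma orthogonal_context_4_iff:
  assumes "{w, x, y, z} \<subseteq> rays" "distinct [w, x, y, z]"
  shows "orthogonal_context {w, x, y, z} \<longleftrightarrow>
    orthogonal_rays w x \<and> orthogonal_rays w y \<and> orthogonal_rays w z \<and>
    orthogonal_rays x y \<and> orthogonal_rays x z \<and> orthogonal_rays y z"
proof -
  have "card {w, x, y, z} = 4" using assms(2) by simp
  moreover have "pairwise orthogonal_rays {w, x, y, z} \<longleftrightarrow>
    orthogonal_rays w x \<and> orthogonal_rays w y \<and> orthogonal_rays w z \<and>
    orthogonal_rays x y \<and> orthogonal_rays x z \<and> orthogonal_rays y z"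
    using assms(2) orthogonal_rays_commute by (simp add: pairwise_insert) metis
  ultimately show ?thesis using assms(1) by (simp add: orthogonal_context_def)
qed

text \<open>The grid is reindexed by \<open>p = ia - jb\<close> and \<open>q = ia + jb\<close>.\<close>

definition A_pt :: "nat \<Rightarrow> real \<Rightarrow> int \<Rightarrow> int \<Rightarrow> V set" where
  "A_pt n c p q = ray (u (2 * pi * of_int p / of_nat n)) (- c *\<^sub>R u (2 * pi * of_int q / of_nat n))"

definition B_pt :: "nat \<Rightarrow> real \<Rightarrow> int \<Rightarrow> int \<Rightarrow> V set" where
  "B_pt n c p q = ray (c *\<^sub>R u (2 * pi * of_int p / of_nat n)) (u (2 * pi * of_int q / of_nat n))"

lemma grid_ray_eq_pt:
  "A_ray n a b c i j = A_pt n c (i * a - j * b) (i * a + j * b)"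
  "B_ray n a b c i j = B_pt n c (i * a - j * b) (i * a + j * b)"
  unfolding A_ray_def B_ray_def u_grid A_pt_def B_pt_def by simp_all

lemma pt_cong:
  assumes "n > 0" "[p = p'] (mod int n)" "[q = q'] (mod int n)"
  shows "A_pt n c p q = A_pt n c p' q'" "B_pt n c p q = B_pt n c p' q'"
  using u_eqI[OF assms(1,2), of 0] u_eqI[OF assms(1,3), of 0] by (simp_all add: A_pt_def B_pt_def)

section \<open>Index arithmetic modulo an odd \<open>n\<close>\<close>

text \<open>Admissibility contributes \<open>c \<noteq> 1\<close>, which keeps the rays of
  \<open>A\<close> apart from those of \<open>B\<close>.\<close>

locale odd_grid =
  fixes n :: nat and a b :: int and c :: real
  assumes n_ge_3: "n \<ge> 3" and odd_n: "odd n"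
    and a_unit: "a \<in> Units (Zmod n)" and b_unit: "b \<in> Units (Zmod n)"
    and c_pos: "c > 0" and c_neq_1: "c \<noteq> 1"
begin

sublocale residues "int n" "Zmod n"
  using n_ge_3 by unfold_locales simp_all

lemma n_pos: "n > 0"
  using n_ge_3 by simp

lemma carrier_Zmod: "carrier (Zmod n) = {0..<int n}"
  by (auto simp: residue_ring_def)

lemma cong_carrier_iff:
  assumes "x \<in> carrier (Zmod n)" "y \<in> carrier (Zmod n)"
  shows "[x = y] (mod int n) \<longleftrightarrow> x = y"
  using assms by (auto simp: carrier_Zmod cong_less_imp_eq_int)

lemma card_carrier: "card (carrier (Zmod n)) = n"
  by (simp add: carrier_Zmod)

lemma coprime_2: "coprime 2 (int n)"
  using odd_n by simp

lemma cong_2_cancel: "[2 * x = 2 * y] (mod int n) \<longleftrightarrow> [x = y] (mod int n)"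
  using coprime_2 by (simp add: cong_mult_lcancel)

text \<open>Since 0 < 2 < \<open>n\<close> and \<open>n\<close> is odd, the residue 2 is itself a
  unit.\<close>

lemma unit_double:
  assumes "x \<in> Units (Zmod n)"
  shows "2 \<otimes>\<^bsub>Zmod n\<^esub> x \<in> Units (Zmod n)"
  using assms n_ge_3 coprime_2 by (intro Units_m_closed) (simp_all add: res_units_eq)

text \<open>Translates the ring inverse into an integer congruence; it serves both index formulas,
  with \<open>x\<close> being \<open>a\<close> or \<open>b\<close>.\<close>

lemma cong_inv_double_mult:
  assumes "x \<in> Units (Zmod n)" "y \<in> carrier (Zmod n)"
  shows "inv\<^bsub>Zmod n\<^esub> (2 \<otimes>\<^bsub>Zmod n\<^esub> x) \<otimes>\<^bsub>Zmod n\<^esub> y \<in> carrier (Zmod n)"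
    and "[2 * x * (inv\<^bsub>Zmod n\<^esub> (2 \<otimes>\<^bsub>Zmod n\<^esub> x) \<otimes>\<^bsub>Zmod n\<^esub> y) = y] (mod int n)"
proof -
  let ?v = "2 \<otimes>\<^bsub>Zmod n\<^esub> x"
  let ?i = "inv\<^bsub>Zmod n\<^esub> ?v \<otimes>\<^bsub>Zmod n\<^esub> y"
  have v: "?v \<in> Units (Zmod n)" using unit_double[OF assms(1)] .
  show "?i \<in> carrier (Zmod n)" using v assms(2) by simp
  have "?v \<otimes>\<^bsub>Zmod n\<^esub> ?i = y"
    using v assms(2) by (metis Units_closed Units_inv_closed Units_r_inv m_assoc l_one)
  then have "2 * x mod int n * ?i mod int n = y" by (simp only: res_mult_eq)
  then have "2 * x * ?i mod int n = y" by (simp only: mod_mult_left_eq)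
  then show "[2 * x * ?i = y] (mod int n)" by (metis cong_mod_left cong_refl)
qed

lemma i_index_closed:
  assumes "r \<in> carrier (Zmod n)" "s \<in> carrier (Zmod n)"
  shows "i_index n a r s \<in> carrier (Zmod n)"
  unfolding i_index_def using cong_inv_double_mult(1)[OF a_unit] assms by simp

lemma j_index_closed:
  assumes "r \<in> carrier (Zmod n)" "s \<in> carrier (Zmod n)"
  shows "j_index n b r s \<in> carrier (Zmod n)"
  unfolding j_index_def using cong_inv_double_mult(1)[OF b_unit] assms by simp

lemma i_index_cong:
  assumes "r \<in> carrier (Zmod n)" "s \<in> carrier (Zmod n)"
  shows "[2 * a * i_index n a r s = r + s] (mod int n)"
proof -
  have "[2 * a * i_index n a r s = r \<oplus>\<^bsub>Zmod n\<^esub> s] (mod int n)"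
    unfolding i_index_def using cong_inv_double_mult(2)[OF a_unit] assms by simp
  then show ?thesis by (simp add: res_add_eq)
qed

lemma j_index_cong:
  assumes "r \<in> carrier (Zmod n)" "s \<in> carrier (Zmod n)"
  shows "[2 * b * j_index n b r s = s - r] (mod int n)"
proof -
  have "[2 * b * j_index n b r s = s \<ominus>\<^bsub>Zmod n\<^esub> r] (mod int n)"
    unfolding j_index_def using cong_inv_double_mult(2)[OF b_unit] assms by simp
  then show ?thesis
    by (simp add: a_minus_def res_add_eq res_neg_eq cong_def mod_add_right_eq)
qed

lemma coprime_double_units: "coprime (2 * a) (int n)" "coprime (2 * b) (int n)"
  using a_unit b_unit coprime_2 by (simp_all add: res_units_eq)

text \<open>Adding and subtracting the two congruences isolates \<open>2 * a * i\<close> and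
  \<open>2 * b * j\<close>. Conversely, the same combinations give back twice the original
  congruences, and 2 is invertible.\<close>

lemma index_pair_iff:
  assumes "r \<in> carrier (Zmod n)" "s \<in> carrier (Zmod n)"
    and "i \<in> carrier (Zmod n)" "j \<in> carrier (Zmod n)"
  shows "[i * a - j * b = r] (mod int n) \<and> [i * a + j * b = s] (mod int n)
    \<longleftrightarrow> i = i_index n a r s \<and> j = j_index n b r s"
    (is "?L \<longleftrightarrow> ?R")
proof -
  have "?L \<longleftrightarrow> [2 * a * i = r + s] (mod int n) \<and> [2 * b * j = s - r] (mod int n)"
    (is "_ \<longleftrightarrow> ?M")
  proof
    assume ?L
    then have "[(i * a - j * b) + (i * a + j * b) = r + s] (mod int n)"
      "[(i * a + j * b) - (i * a - j * b) = s - r] (mod int n)"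
      by (blast intro: cong_add cong_diff)+
    then show ?M by (simp add: algebra_simps)
  next
    assume ?M
    then have "[2 * a * i - 2 * b * j = (r + s) - (s - r)] (mod int n)"
      "[2 * a * i + 2 * b * j = (r + s) + (s - r)] (mod int n)"
      by (blast intro: cong_add cong_diff)+
    then have "[2 * (i * a - j * b) = 2 * r] (mod int n)" "[2 * (i * a + j * b) = 2 * s] (mod int n)"
      by (simp_all add: algebra_simps)
    then show ?L by (simp only: cong_2_cancel)
  qed
  \<comment> \<open>Once the right-hand sides are expressed through the claimed indices, the units
    \<open>2 * a\<close> and \<open>2 * b\<close> can be cancelled.\<close>
  also have "\<dots> \<longleftrightarrow> [2 * a * i = 2 * a * i_index n a r s] (mod int n) \<and>
      [2 * b * j = 2 * b * j_index n b r s] (mod int n)"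
    using i_index_cong[OF assms(1,2)] j_index_cong[OF assms(1,2)] by (simp only: cong_def)
  also have "\<dots> \<longleftrightarrow> ?R"
    using assms i_index_closed j_index_closed coprime_double_units
    by (simp add: cong_mult_lcancel cong_carrier_iff)
  finally show ?thesis .
qed

section \<open>Coincidences between rays\<close>

lemma completion_ray_neq:
  "P_ray n r \<noteq> P'_ray n s"
  "P_ray n r \<noteq> A_pt n c p q" "P_ray n r \<noteq> B_pt n c p q"
  "P'_ray n s \<noteq> A_pt n c p q" "P'_ray n s \<noteq> B_pt n c p q"
  using c_pos by (auto simp: P_ray_def P'_ray_def A_pt_def B_pt_def dest!: ray_eq_imp_zero_iff)

text \<open>Comparing norms in both components, a proportionality factor \<open>k\<close> would
  satisfy \<open>\<bar>k\<bar> * c = 1\<close> and \<open>\<bar>k\<bar> = c\<close>, hence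
  \<open>c * c = 1\<close>.\<close>

lemma A_pt_neq_B_pt: "A_pt n c p q \<noteq> B_pt n c p' q'"
proof
  assume "A_pt n c p q = B_pt n c p' q'"
  then obtain k where
    "u (2 * pi * of_int p / of_nat n) = k *\<^sub>R c *\<^sub>R u (2 * pi * of_int p' / of_nat n)"
    "- c *\<^sub>R u (2 * pi * of_int q / of_nat n) = k *\<^sub>R u (2 * pi * of_int q' / of_nat n)"
    unfolding A_pt_def B_pt_def by (rule ray_eqD)
  then have "1 = \<bar>k\<bar> * c" "c = \<bar>k\<bar>"
    using c_pos by (metis norm_u norm_scaleR mult.right_neutral abs_of_pos abs_minus_cancel)+
  then have "c * c = 1" by simp
  then show False using c_pos c_neq_1 by (auto simp: square_eq_1_iff)
qed

lemma P_ray_eq_iff: "P_ray n r = P_ray n r' \<longleftrightarrow> [r = r'] (mod int n)"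
  using P_ray_cong(1)[OF n_pos] by (auto simp: P_ray_def intro: u_parallel_imp_cong[OF odd_n] elim!: ray_eqD)

lemma P'_ray_eq_iff: "P'_ray n s = P'_ray n s' \<longleftrightarrow> [s = s'] (mod int n)"
  using P_ray_cong(2)[OF n_pos] by (auto simp: P'_ray_def intro: u_parallel_imp_cong[OF odd_n] elim!: ray_eqD)

lemma A_pt_eq_iff:
  "A_pt n c p q = A_pt n c p' q' \<longleftrightarrow> [p = p'] (mod int n) \<and> [q = q'] (mod int n)"
proof
  assume "A_pt n c p q = A_pt n c p' q'"
  \<comment> \<open>The scalars are commuted so that the nonzero factor \<open>- c\<close> stands in
    front on both sides and cancels.\<close>
  then obtain k where
    "u (2 * pi * of_int p / of_nat n) = k *\<^sub>R u (2 * pi * of_int p' / of_nat n)"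
    "- c *\<^sub>R u (2 * pi * of_int q / of_nat n) = - c *\<^sub>R k *\<^sub>R u (2 * pi * of_int q' / of_nat n)"
    unfolding A_pt_def scaleR_left_commute[of "- c"] by (rule ray_eqD)
  then show "[p = p'] (mod int n) \<and> [q = q'] (mod int n)"
    using u_parallel_imp_cong[OF odd_n, of 0] c_pos
    by (simp only: scaleR_cancel_left) simp
qed (use pt_cong[OF n_pos] in blast)

lemma B_pt_eq_iff:
  "B_pt n c p q = B_pt n c p' q' \<longleftrightarrow> [p = p'] (mod int n) \<and> [q = q'] (mod int n)"
proof
  assume "B_pt n c p q = B_pt n c p' q'"
  then obtain k where
    "c *\<^sub>R u (2 * pi * of_int p / of_nat n) = c *\<^sub>R k *\<^sub>R u (2 * pi * of_int p' / of_nat n)"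
    "u (2 * pi * of_int q / of_nat n) = k *\<^sub>R u (2 * pi * of_int q' / of_nat n)"
    unfolding B_pt_def scaleR_left_commute[of c] by (rule ray_eqD)
  then show "[p = p'] (mod int n) \<and> [q = q'] (mod int n)"
    using u_parallel_imp_cong[OF odd_n, of 0] c_pos
    by (simp only: scaleR_cancel_left) simp
qed (use pt_cong[OF n_pos] in blast)

section \<open>Orthogonality criterion for the new contexts\<close>

text \<open>\<open>P_ray n r\<close> and \<open>P'_ray n s\<close> lie in complementary orthogonal
  summands, and \<open>A_pt\<close> is orthogonal to \<open>B_pt\<close> at the same
  \<open>(p, q)\<close> because the two contributions \<open>c\<close> and \<open>- c\<close>
  cancel. The other four pairs involve one component each and reduce to the quarter-turn
  criterion.\<close>

lemma orthogonal_context_pt_iff: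
  "orthogonal_context {P_ray n r, P'_ray n s, A_pt n c p q, B_pt n c p q}
    \<longleftrightarrow> [p = r] (mod int n) \<and> [q = s] (mod int n)"
    (is "orthogonal_context ?C \<longleftrightarrow> _")
proof -
  have "?C \<subseteq> rays"
    using c_pos by (simp add: P_ray_def P'_ray_def A_pt_def B_pt_def ray_in_rays)
  moreover have "distinct [P_ray n r, P'_ray n s, A_pt n c p q, B_pt n c p q]"
    using completion_ray_neq A_pt_neq_B_pt by simp
  moreover have
    "orthogonal_rays (P_ray n r) (P'_ray n s)"
    "orthogonal_rays (A_pt n c p q) (B_pt n c p q)"
    "orthogonal_rays (P_ray n r) (A_pt n c p q) \<longleftrightarrow> [p = r] (mod int n)"
    "orthogonal_rays (P_ray n r) (B_pt n c p q) \<longleftrightarrow> [p = r] (mod int n)"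
    "orthogonal_rays (P'_ray n s) (A_pt n c p q) \<longleftrightarrow> [q = s] (mod int n)"
    "orthogonal_rays (P'_ray n s) (B_pt n c p q) \<longleftrightarrow> [q = s] (mod int n)"
    using c_pos
    by (simp_all add: P_ray_def P'_ray_def A_pt_def B_pt_def orthogonal_rays_ray_iff
        inner_u_quarter_turn_eq_0_iff[OF odd_n] inner_u[of x x for x])
  ultimately show ?thesis
    using orthogonal_context_4_iff by simp
qed

lemma orthogonal_context_D_set_iff:
  assumes "r \<in> carrier (Zmod n)" "s \<in> carrier (Zmod n)"
    and "i \<in> carrier (Zmod n)" "j \<in> carrier (Zmod n)"
  shows "orthogonal_context (D_set n a b c r s i j)
    \<longleftrightarrow> i = i_index n a r s \<and> j = j_index n b r s"
  unfolding D_set_def grid_ray_eq_pt orthogonal_context_pt_iff using index_pair_iff[OF assms] .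

section \<open>The family of contexts and its incidence counts\<close>

text \<open>In the coordinates \<open>(p, q)\<close> the matching grid index is
  \<open>(r, s)\<close> itself, so no modular inverses appear.\<close>

definition D_pt :: "int \<Rightarrow> int \<Rightarrow> V set set" where
  "D_pt r s = {P_ray n r, P'_ray n s, A_pt n c r s, B_pt n c r s}"

lemma D_set_index_eq_D_pt:
  assumes "r \<in> carrier (Zmod n)" "s \<in> carrier (Zmod n)"
  shows "D_set n a b c r s (i_index n a r s) (j_index n b r s) = D_pt r s"
proof -
  let ?i = "i_index n a r s" and ?j = "j_index n b r s"
  have "[?i * a - ?j * b = r] (mod int n)" "[?i * a + ?j * b = s] (mod int n)"
    using index_pair_iff[OF assms i_index_closed[OF assms] j_index_closed[OF assms]] by simp_all
  then show ?thesis
    by (simp add: D_set_def D_pt_def grid_ray_eq_pt pt_cong[OF n_pos])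
qed

lemma D_family_eq_image:
  "D_family n a b c = (\<lambda>(r, s). D_pt r s) ` (carrier (Zmod n) \<times> carrier (Zmod n))"
  unfolding D_family_def by (force simp: D_set_index_eq_D_pt)

text \<open>Rays of different kinds never coincide, so only the member of the same kind has to be
  compared.\<close>

lemma mem_D_pt_iff:
  "P_ray n r \<in> D_pt r' s' \<longleftrightarrow> [r = r'] (mod int n)"
  "P'_ray n s \<in> D_pt r' s' \<longleftrightarrow> [s = s'] (mod int n)"
  "A_pt n c p q \<in> D_pt r' s' \<longleftrightarrow> [p = r'] (mod int n) \<and> [q = s'] (mod int n)"
  "B_pt n c p q \<in> D_pt r' s' \<longleftrightarrow> [p = r'] (mod int n) \<and> [q = s'] (mod int n)"
  using completion_ray_neq completion_ray_neq[symmetric] A_pt_neq_B_pt A_pt_neq_B_pt[symmetric]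
  by (simp_all add: D_pt_def P_ray_eq_iff P'_ray_eq_iff A_pt_eq_iff B_pt_eq_iff)

text \<open>The two completion rays in a context already determine \<open>(r, s)\<close>.\<close>

lemma inj_on_D_pt: "inj_on (\<lambda>(r, s). D_pt r s) (carrier (Zmod n) \<times> carrier (Zmod n))"
proof (rule inj_onI, clarify)
  fix r s r' s'
  assume *: "r \<in> carrier (Zmod n)" "s \<in> carrier (Zmod n)"
    "r' \<in> carrier (Zmod n)" "s' \<in> carrier (Zmod n)" and eq: "D_pt r s = D_pt r' s'"
  have "P_ray n r \<in> D_pt r' s'" "P'_ray n s \<in> D_pt r' s'"
    unfolding eq[symmetric] by (simp_all add: D_pt_def)
  then show "r = r' \<and> s = s'"
    using * by (simp add: mem_D_pt_iff cong_carrier_iff)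
qed

text \<open>Injectivity turns counting contexts through a ray into counting index pairs.\<close>

lemma card_containing:
  "card {C \<in> D_family n a b c. x \<in> C}
    = card {(r, s) \<in> carrier (Zmod n) \<times> carrier (Zmod n). x \<in> D_pt r s}"
proof -
  have "{C \<in> D_family n a b c. x \<in> C}
      = (\<lambda>(r, s). D_pt r s) ` {(r, s) \<in> carrier (Zmod n) \<times> carrier (Zmod n). x \<in> D_pt r s}"
    unfolding D_family_eq_image by auto
  moreover have "inj_on (\<lambda>(r, s). D_pt r s)
      {(r, s) \<in> carrier (Zmod n) \<times> carrier (Zmod n). x \<in> D_pt r s}"
    by (rule inj_on_subset[OF inj_on_D_pt]) auto
  ultimately show ?thesis by (simp only: card_image)
qed

lemma card_D_family: "card (D_family n a b c) = n\<^sup>2"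
  unfolding D_family_eq_image
  by (simp add: card_image inj_on_D_pt card_cartesian_product card_carrier power2_eq_square)

lemma card_containing_P_ray:
  assumes "r \<in> carrier (Zmod n)"
  shows "card {C \<in> D_family n a b c. P_ray n r \<in> C} = n"
proof -
  have "{(r', s) \<in> carrier (Zmod n) \<times> carrier (Zmod n). P_ray n r \<in> D_pt r' s}
      = {r} \<times> carrier (Zmod n)"
    using assms by (auto simp: mem_D_pt_iff cong_carrier_iff)
  then show ?thesis
    by (simp add: card_containing card_cartesian_product card_carrier)
qed

lemma card_containing_P'_ray:
  assumes "s \<in> carrier (Zmod n)"
  shows "card {C \<in> D_family n a b c. P'_ray n s \<in> C} = n"
proof -
  have "{(r, s') \<in> carrier (Zmod n) \<times> carrier (Zmod n). P'_ray n s \<in> D_pt r s'}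
      = carrier (Zmod n) \<times> {s}"
    using assms by (auto simp: mem_D_pt_iff cong_carrier_iff)
  then show ?thesis
    by (simp add: card_containing card_cartesian_product card_carrier)
qed

lemma cong_carrier_iff_mod:
  assumes "y \<in> carrier (Zmod n)"
  shows "[x = y] (mod int n) \<longleftrightarrow> y = x mod int n"
  using assms by (auto simp: carrier_Zmod cong_def)

text \<open>Both coordinates of the context are forced modulo \<open>n\<close>, and each class has
  one representative in the carrier.\<close>

lemma card_containing_grid_pt:
  "card {C \<in> D_family n a b c. A_pt n c p q \<in> C} = 1"
  "card {C \<in> D_family n a b c. B_pt n c p q \<in> C} = 1"
proof -
  have *: "x mod int n \<in> carrier (Zmod n)" for x
    using n_pos by (simp add: carrier_Zmod)
  have "{(r, s) \<in> carrier (Zmod n) \<times> carrier (Zmod n). A_pt n c p q \<in> D_pt r s}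
      = {(p mod int n, q mod int n)}"
    "{(r, s) \<in> carrier (Zmod n) \<times> carrier (Zmod n). B_pt n c p q \<in> D_pt r s}
      = {(p mod int n, q mod int n)}"
    using * by (auto simp: mem_D_pt_iff cong_carrier_iff_mod)
  then show "card {C \<in> D_family n a b c. A_pt n c p q \<in> C} = 1"
    "card {C \<in> D_family n a b c. B_pt n c p q \<in> C} = 1"
    by (simp_all add: card_containing)
qed

section \<open>The contexts lie in the completion but not in the original grid\<close>

lemma D_family_orthogonal_context:
  assumes "C \<in> D_family n a b c"
  shows "orthogonal_context C"
  using assms unfolding D_family_def
  by (auto simp: orthogonal_context_D_set_iff i_index_closed j_index_closed)

lemma D_family_subset_Z_completion:
  assumes "C \<in> D_family n a b c"
  shows "C \<subseteq> Z_completion n a b c"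
proof -
  obtain r s where rs: "r \<in> carrier (Zmod n)" "s \<in> carrier (Zmod n)"
    and C: "C = D_set n a b c r s (i_index n a r s) (j_index n b r s)"
    using assms unfolding D_family_def by blast
  show ?thesis
    unfolding C D_set_def Z_completion_def Z_config_def X_orbit_def X'_orbit_def A_orbit_def B_orbit_def
    using rs i_index_closed[OF rs] j_index_closed[OF rs] by blast
qed

text \<open>Every member contains some \<open>P_ray n r\<close>, whose second component vanishes,
  unlike that of any grid ray.\<close>

lemma D_family_not_subset_Z_config:
  assumes "C \<in> D_family n a b c"
  shows "\<not> C \<subseteq> Z_config n a b c"
proof -
  obtain r where "P_ray n r \<in> C"
    using assms unfolding D_family_def D_set_def by blast
  moreover have "P_ray n r \<notin> Z_config n a b c"
    using completion_ray_neq by (auto simp: Z_config_def A_orbit_def B_orbit_def grid_ray_eq_pt)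
  ultimately show ?thesis by blast
qed

end

theorem theorem6p4:
  fixes n :: nat and a b :: int and c :: real
  assumes "n \<ge> 3" and "odd n"
    and "a \<in> Units (Zmod n)" and "b \<in> Units (Zmod n)"
    and "admissible n a b"
    and "c > 0" and "c\<^sup>2 = ratio n a b"
  shows "(\<forall>r\<in>carrier (Zmod n). \<forall>s\<in>carrier (Zmod n).
            (\<exists>!(i, j)\<in>carrier (Zmod n) \<times> carrier (Zmod n).
               orthogonal_context (D_set n a b c r s i j)) \<and>
            (\<forall>i\<in>carrier (Zmod n). \<forall>j\<in>carrier (Zmod n).
               orthogonal_context (D_set n a b c r s i j) \<longrightarrow>
               i = i_index n a r s \<and> j = j_index n b r s)) \<and>
         card (D_family n a b c) = n\<^sup>2 \<and>
         (\<forall>C\<in>D_family n a b c. orthogonal_context C \<and>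
            C \<subseteq> Z_completion n a b c \<and> \<not> C \<subseteq> Z_config n a b c) \<and>
         (\<forall>i\<in>carrier (Zmod n). \<forall>j\<in>carrier (Zmod n).
            card {C \<in> D_family n a b c. A_ray n a b c i j \<in> C} = 1 \<and>
            card {C \<in> D_family n a b c. B_ray n a b c i j \<in> C} = 1) \<and>
         (\<forall>r\<in>carrier (Zmod n). card {C \<in> D_family n a b c. P_ray n r \<in> C} = n) \<and>
         (\<forall>s\<in>carrier (Zmod n). card {C \<in> D_family n a b c. P'_ray n s \<in> C} = n)"
proof -
  \<comment> \<open>If \<open>c\<close> were 1, the ratio \<open>c\<^sup>2\<close> would be the
    excluded value 1.\<close>
  have "c \<noteq> 1" using assms(5,7) by (auto simp: admissible_def)
  then interpret odd_grid n a b c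
    using assms by unfold_locales
  have unique: "\<exists>!(i, j)\<in>carrier (Zmod n) \<times> carrier (Zmod n).
      orthogonal_context (D_set n a b c r s i j)"
    if "r \<in> carrier (Zmod n)" "s \<in> carrier (Zmod n)" for r s
    using that
    by (intro ex1I[of _ "(i_index n a r s, j_index n b r s)"])
      (auto simp: orthogonal_context_D_set_iff i_index_closed j_index_closed)
  show ?thesis
    using unique orthogonal_context_D_set_iff card_D_family D_family_orthogonal_context
      D_family_subset_Z_completion D_family_not_subset_Z_config card_containing_grid_pt card_containing_P_ray card_containing_P'_ray
    by (simp add: grid_ray_eq_pt)
qed

end
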